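(* Let $n\in\mathbb{N}$, let $S_1,\ldots,S_n$ be pairwise disjoint finite semigroups, let $S$ be their zero-union, and let $\mathit{NC}=\{i\in\{1,\ldots,n\} : S_i \text{ is not commutative}\}$. Suppose that $|\mathit{NC}|\geqslant 2$. Then $\mathcal{G}(S)$ is connected and $\mathrm{diam}(\mathcal{G}(S))=2$.
   Context: Zero-union: for pairwise disjoint semigroups $S_1,\ldots,S_n$, their zero-union is the set $\{0\}\cup\bigcup_{i=1}^n S_i$, where $0$ is a new element, and where the product of $x$ and $y$ is the element $xy\in S_i$ if $x,y\in S_i$ for some $i$, and is $0$ in all remaining cases. The center of a semigroup $T$ is $Z(T)=\{x\in T: xy=yx \text{ for all } y\in T\}$. For a finite non-commutative semigroup $T$, the commuting graph $\mathcal{G}(T)$ is the simple graph with vertex set $T\setminus Z(T)$ in which two distinct vertices $x,y$ are adjacent if and only if $xy=yx$. The distance between two vertices is the length (number of edges) of a shortest path between them ($\infty$ if there is none), and $\mathrm{diam}(G)$ is the maximum distance between vertices of $G$. *)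

theory Defs
  imports "Graph_Theory.Graph_Theory" "HOL-Library.Extended_Nat"
begin

section \<open>Semigroups on a carrier set\<close>

locale semigroup_on =
  fixes A :: "'a set" and f :: "'a \<Rightarrow> 'a \<Rightarrow> 'a"
  assumes nonempty: "A \<noteq> {}"
    and closed: "\<lbrakk>x \<in> A; y \<in> A\<rbrakk> \<Longrightarrow> f x y \<in> A"
    and assoc: "\<lbrakk>x \<in> A; y \<in> A; z \<in> A\<rbrakk> \<Longrightarrow> f (f x y) z = f x (f y z)"

definition commutative_on :: "'a set \<Rightarrow> ('a \<Rightarrow> 'a \<Rightarrow> 'a) \<Rightarrow> bool" where
  "commutative_on A f \<longleftrightarrow> (\<forall>x\<in>A. \<forall>y\<in>A. f x y = f y x)"

definition center :: "'a set \<Rightarrow> ('a \<Rightarrow> 'a \<Rightarrow> 'a) \<Rightarrow> 'a set" where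
  "center A f = {x \<in> A. \<forall>y\<in>A. f x y = f y x}"


section \<open>Zero-unions\<close>

text \<open>The new zero is \<^term>\<open>None\<close>; an element \<open>a\<close> of a summand appears as \<open>Some a\<close>.\<close>

definition zero_union :: "'i set \<Rightarrow> ('i \<Rightarrow> 'a set) \<Rightarrow> 'a option set" where
  "zero_union I S = {None} \<union> (\<Union>i\<in>I. Some ` S i)"

text \<open>The index in the product is unique only for pairwise disjoint summands.\<close>

definition zero_union_mult ::
    "'i set \<Rightarrow> ('i \<Rightarrow> 'a set) \<Rightarrow> ('i \<Rightarrow> 'a \<Rightarrow> 'a \<Rightarrow> 'a) \<Rightarrow> 'a option \<Rightarrow> 'a option \<Rightarrow> 'a option" where
  "zero_union_mult I S m x y =
    (case (x, y) of
       (Some a, Some b) \<Rightarrow>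
         if \<exists>i\<in>I. a \<in> S i \<and> b \<in> S i
         then Some (m (THE i. i \<in> I \<and> a \<in> S i \<and> b \<in> S i) a b)
         else None
     | _ \<Rightarrow> None)"

lemma zero_union_mult_same:
  assumes "disjoint_family_on S I" "i \<in> I" "a \<in> S i" "b \<in> S i"
  shows "zero_union_mult I S m (Some a) (Some b) = Some (m i a b)"
proof -
  have "(THE j. j \<in> I \<and> a \<in> S j \<and> b \<in> S j) = i"
    using assms by (intro the_equality) (auto simp: disjoint_family_on_def)
  with assms show ?thesis by (auto simp: zero_union_mult_def)
qed

lemma zero_union_mult_other:
  assumes "\<not> (\<exists>i\<in>I. \<exists>a\<in>S i. \<exists>b\<in>S i. x = Some a \<and> y = Some b)"
  shows "zero_union_mult I S m x y = None"
  using assms by (auto simp: zero_union_mult_def split: option.splits)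

lemma semigroup_on_zero_union:
  assumes dis: "disjoint_family_on S I" and sg: "\<And>i. i \<in> I \<Longrightarrow> semigroup_on (S i) (m i)"
  shows "semigroup_on (zero_union I S) (zero_union_mult I S m)"
proof
  let ?f = "zero_union_mult I S m"
  show "zero_union I S \<noteq> {}" by (simp add: zero_union_def)
  have cl: "m i a b \<in> S i" if "i \<in> I" "a \<in> S i" "b \<in> S i" for i a b
    using semigroup_on.closed[OF sg] that by blast
  have same: "?f (Some a) (Some b) = Some (m i a b)" if "i \<in> I" "a \<in> S i" "b \<in> S i" for i a b
    using zero_union_mult_same[OF dis that] .
  have idx: "i = j" if "i \<in> I" "j \<in> I" "a \<in> S i" "a \<in> S j" for i j a
    using disjoint_family_onD[OF dis, of i j] that by auto
  have other: "?f (Some a) (Some b) = None"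
    if "i \<in> I" "j \<in> I" "i \<noteq> j" "a \<in> S i" "b \<in> S j" for i j a b
  proof (rule zero_union_mult_other, rule notI)
    assume "\<exists>k\<in>I. \<exists>a'\<in>S k. \<exists>b'\<in>S k. Some a = Some a' \<and> Some b = Some b'"
    then obtain k where "k \<in> I" "a \<in> S k" "b \<in> S k" by auto
    with that idx[of i k a] idx[of j k b] show False by simp
  qed
  have zero: "?f None x = None" "?f x None = None" for x
    by (auto simp: zero_union_mult_def split: option.splits)
  show "?f x y \<in> zero_union I S" if "x \<in> zero_union I S" "y \<in> zero_union I S" for x y
  proof (cases "\<exists>i\<in>I. \<exists>a\<in>S i. \<exists>b\<in>S i. x = Some a \<and> y = Some b")
    case True
    then obtain i a b where "i \<in> I" "a \<in> S i" "b \<in> S i" "x = Some a" "y = Some b" by blast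
    with cl[of i a b] show ?thesis by (auto simp: same zero_union_def)
  next
    case False
    then show ?thesis by (simp add: zero_union_mult_other zero_union_def)
  qed
  show "?f (?f x y) z = ?f x (?f y z)"
    if xyz: "x \<in> zero_union I S" "y \<in> zero_union I S" "z \<in> zero_union I S" for x y z
  proof (cases "x = None \<or> y = None \<or> z = None")
    case True
    then show ?thesis by (auto simp: zero)
  next
    case False
    then obtain i j k a b c where *: "i \<in> I" "j \<in> I" "k \<in> I" "a \<in> S i" "b \<in> S j" "c \<in> S k"
        "x = Some a" "y = Some b" "z = Some c"
      using xyz by (auto simp: zero_union_def)
    show ?thesis
    proof (cases "i = j")
      case ij: True
      show ?thesis
      proof (cases "j = k")
        case True
        with * ij semigroup_on.assoc[OF sg] show ?thesis by (simp add: same cl)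
      next
        case False
        with * ij other[of j k] show ?thesis by (simp add: same[of j] cl zero)
      qed
    next
      case ij: False
      show ?thesis
      proof (cases "j = k")
        case True
        with * ij other[of i j] show ?thesis by (simp add: same[of j] cl zero)
      next
        case False
        with * ij other[of i j] other[of j k] show ?thesis by (simp add: zero)
      qed
    qed
  qed
qed


section \<open>Commuting graphs\<close>

text \<open>An undirected edge is represented by its two opposite arcs.\<close>

definition commuting_graph :: "'a set \<Rightarrow> ('a \<Rightarrow> 'a \<Rightarrow> 'a) \<Rightarrow> 'a pair_pre_digraph" where
  "commuting_graph A f =
    \<lparr> pverts = A - center A f,
      parcs = {(x, y). x \<in> A - center A f \<and> y \<in> A - center A f \<and> x \<noteq> y \<and> f x y = f y x} \<rparr>"

lemma pair_graph_commuting_graph: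
  assumes "finite A"
  shows "pair_graph (commuting_graph A f)"
proof
  show "finite (pverts (commuting_graph A f))"
    using assms by (simp add: commuting_graph_def)
  show "finite (parcs (commuting_graph A f))"
    by (rule finite_subset[of _ "A \<times> A"]) (use assms in \<open>auto simp: commuting_graph_def\<close>)
  show "symmetric (with_proj (commuting_graph A f))"
    by (auto simp: symmetric_def sym_def commuting_graph_def arcs_ends_conv)
qed (auto simp: commuting_graph_def)


section \<open>Distance and diameter\<close>

text \<open>
  The infimum of the empty set is \<open>\<infinity>\<close>. The supremum is a maximum whenever the graph is finite
  and has a vertex.
\<close>

definition graph_dist :: "('a, 'b) pre_digraph \<Rightarrow> 'a \<Rightarrow> 'a \<Rightarrow> enat" where
  "graph_dist G u v = (INF p \<in> {p. pre_digraph.apath G u p v}. enat (length p))"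

definition graph_diam :: "('a, 'b) pre_digraph \<Rightarrow> enat" where
  "graph_diam G = (SUP (u, v) \<in> verts G \<times> verts G. graph_dist G u v)"

lemma graph_diam_eq_Max:
  assumes "finite (verts G)" "verts G \<noteq> {}"
  shows "graph_diam G = Max ((\<lambda>(u, v). graph_dist G u v) ` (verts G \<times> verts G))"
  using assms unfolding graph_diam_def by (intro cSup_eq_Max) auto

end

theory Submission
  imports Defs
begin

text \<open>
  Elements of two different summands multiply to the zero in either order, so they commute, and
  elements of the same summand commute in the zero-union exactly when they commute in that summand.
  The vertices of the commuting graph are therefore the non-central elements of the summands
  (\<open>noncentral_zero_union\<close>); the zero and the commutative summands contribute none. Vertices from
  different summands are adjacent. Two vertices from the same summand have a common neighbour in
  any other non-commutative summand, and there is one because at least two summands are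
  non-commutative. So every distance is at most 2. A non-commutative summand contains two elements
  that do not commute; they are distinct non-adjacent vertices, so the distance 2 is attained.
  Connectedness follows from the finite diameter.
\<close>

section \<open>Distance and diameter in directed graphs\<close>

lemma (in wf_digraph) graph_dist_le_two:
  assumes "u \<in> verts G" and "u = v \<or> u \<rightarrow>\<^bsub>G\<^esub> v \<or> (\<exists>w. u \<rightarrow>\<^bsub>G\<^esub> w \<and> w \<rightarrow>\<^bsub>G\<^esub> v)"
  shows "graph_dist G u v \<le> 2"
proof -
  have "\<exists>p. apath u p v \<and> length p \<le> 2"
  proof (cases "u = v \<or> u \<rightarrow>\<^bsub>G\<^esub> v")
    case True
    show ?thesis
    proof (cases "u = v")
      case True
      with assms(1) have "apath u [] v" by (simp add: apath_Nil_iff)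
      then show ?thesis by force
    next
      case False
      with True obtain e where "arc e (u, v)"
        by (auto simp: arcs_ends_conv arc_def)
      with False have "apath u [e] v" by (auto simp: apath_simps elim!: arcE)
      then show ?thesis by force
    qed
  next
    (* The walk u, w, v repeats no vertex: w = u or w = v would make u and v adjacent. *)
    case False
    with assms(2) obtain w where w: "u \<rightarrow>\<^bsub>G\<^esub> w" "w \<rightarrow>\<^bsub>G\<^esub> v" by blast
    then obtain e f where "arc e (u, w)" "arc f (w, v)"
      by (auto simp: arcs_ends_conv arc_def)
    moreover from False w have "u \<noteq> v" "u \<noteq> w" "w \<noteq> v" by auto
    ultimately have "apath u [e, f] v" by (auto simp: apath_simps elim!: arcE)
    then show ?thesis by force
  qed
  then obtain p where "apath u p v" and len: "length p \<le> 2" by blast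
  then have "graph_dist G u v \<le> enat (length p)"
    unfolding graph_dist_def by (intro INF_lower) simp
  also from len have "\<dots> \<le> 2" by (simp add: numeral_eq_enat)
  finally show ?thesis .
qed

lemma (in wf_digraph) graph_dist_ge_two:
  assumes "u \<noteq> v" and "\<not> u \<rightarrow>\<^bsub>G\<^esub> v"
  shows "2 \<le> graph_dist G u v"
  unfolding graph_dist_def
proof (rule INF_greatest)
  fix p assume "p \<in> {p. apath u p v}"
  then have walk: "awalk u p v" by (auto intro: awalkI_apath)
  have "2 \<le> length p"
  proof (rule ccontr)
    assume "\<not> 2 \<le> length p"
    then consider "p = []" | e where "p = [e]" by (cases p; cases "tl p") auto
    then show False
      using walk assms by cases (auto simp: awalk_simps dest: in_arcs_imp_in_arcs_ends)
  qed
  then show "2 \<le> enat (length p)" by (simp add: numeral_eq_enat)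
qed

text \<open>
  If \<open>v\<close> cannot be reached from \<open>u\<close>, their distance is the infimum of the empty set, which is
  \<open>\<infinity>\<close>, and this makes the diameter infinite.
\<close>

lemma (in wf_digraph) connected_if_graph_diam_finite:
  assumes "verts G \<noteq> {}" and "graph_diam G \<noteq> \<infinity>"
  shows "connected G"
proof -
  have "u \<rightarrow>\<^sup>*\<^bsub>mk_symmetric G\<^esub> v" if "u \<in> verts G" "v \<in> verts G" for u v
  proof -
    have "graph_dist G u v \<le> graph_diam G"
      unfolding graph_diam_def using that by (intro SUP_upper2[of "(u, v)"]) auto
    with assms(2) have "graph_dist G u v \<noteq> \<infinity>" by (metis enat_ord_simps(5))
    then have "{p. apath u p v} \<noteq> {}"
      unfolding graph_dist_def by (metis image_empty Inf_empty top_enat_def)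
    then obtain p where "awalk u p v" by (auto dest: awalkI_apath)
    then have "u \<rightarrow>\<^sup>* v" by (rule reachable_awalkI)
    then show ?thesis by (rule reachable_mk_symmetricI)
  qed
  with assms(1) show ?thesis unfolding connected_def strongly_connected_def by simp
qed

section \<open>Commutation in zero-unions\<close>

lemma zero_union_mult_distinct:
  assumes "disjoint_family_on S I" and "i \<in> I" "j \<in> I" "i \<noteq> j" and "a \<in> S i" "b \<in> S j"
  shows "zero_union_mult I S m (Some a) (Some b) = None"
proof (rule zero_union_mult_other, rule notI)
  assume "\<exists>k\<in>I. \<exists>a'\<in>S k. \<exists>b'\<in>S k. Some a = Some a' \<and> Some b = Some b'"
  then obtain k where "k \<in> I" "a \<in> S k" "b \<in> S k" by auto
  with assms show False unfolding disjoint_family_on_def by (metis disjoint_iff)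
qed

text \<open>
  Products with the zero and products across summands are zero in both orders. Whether an element
  of \<open>S i\<close> is central is thus decided inside \<open>S i\<close> alone.
\<close>

lemma noncentral_zero_union:
  assumes dis: "disjoint_family_on S I"
  shows "zero_union I S - center (zero_union I S) (zero_union_mult I S m) =
    (\<Union>i\<in>I. Some ` (S i - center (S i) (m i)))"
proof -
  let ?U = "zero_union I S" and ?f = "zero_union_mult I S m"
  have zero: "?f None x = None" "?f x None = None" for x
    by (auto simp: zero_union_mult_def split: option.splits)
  have "None \<in> center ?U ?f"
    by (simp add: center_def zero zero_union_def)
  moreover have "Some a \<in> center ?U ?f \<longleftrightarrow> a \<in> center (S i) (m i)" if i: "i \<in> I" "a \<in> S i" for i a
  proof
    assume "Some a \<in> center ?U ?f"
    then have "?f (Some a) (Some b) = ?f (Some b) (Some a)" if "b \<in> S i" for b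
      using that i by (auto simp: center_def zero_union_def)
    with i show "a \<in> center (S i) (m i)"
      by (simp add: center_def zero_union_mult_same[OF dis i(1)])
  next
    assume a: "a \<in> center (S i) (m i)"
    have "?f (Some a) y = ?f y (Some a)" if y: "y \<in> ?U" for y
    proof (cases y)
      case None
      then show ?thesis by (simp add: zero)
    next
      case (Some b)
      with y obtain j where j: "j \<in> I" "b \<in> S j" by (auto simp: zero_union_def)
      show ?thesis
      proof (cases "j = i")
        case True
        with a i j Some show ?thesis by (simp add: center_def zero_union_mult_same[OF dis i(1)])
      next
        case False
        with i j Some show ?thesis by (simp add: zero_union_mult_distinct[OF dis])
      qed
    qed
    with i show "Some a \<in> center ?U ?f" by (auto simp: center_def zero_union_def)
  qed
  ultimately show ?thesis by (auto simp: zero_union_def)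
qed

section \<open>The commuting graph of a zero-union\<close>

lemma wf_digraph_commuting_graph: "wf_digraph (with_proj (commuting_graph A f))"
  by unfold_locales (auto simp: commuting_graph_def)

lemma commuting_graph_zero_union:
  fixes S :: "'i \<Rightarrow> 'a set"
  assumes dis: "disjoint_family_on S I"
    and nc: "i \<in> I" "j \<in> I" "i \<noteq> j" "\<not> commutative_on (S i) (m i)" "\<not> commutative_on (S j) (m j)"
  defines "G \<equiv> with_proj (commuting_graph (zero_union I S) (zero_union_mult I S m))"
  shows "connected G" and "graph_diam G = 2"
proof -
  let ?f = "zero_union_mult I S m"
  let ?N = "\<lambda>k. S k - center (S k) (m k)"
  interpret wf_digraph G unfolding G_def by (rule wf_digraph_commuting_graph)
  have verts: "verts G = (\<Union>k\<in>I. Some ` ?N k)"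
    by (simp add: G_def commuting_graph_def noncentral_zero_union[OF dis])
  have adj: "x \<rightarrow>\<^bsub>G\<^esub> y \<longleftrightarrow> x \<in> verts G \<and> y \<in> verts G \<and> x \<noteq> y \<and> ?f x y = ?f y x" for x y
    by (simp add: G_def commuting_graph_def)
  have adj_distinct: "Some a \<rightarrow>\<^bsub>G\<^esub> Some b"
    if "k \<in> I" "l \<in> I" "k \<noteq> l" "a \<in> ?N k" "b \<in> ?N l" for k l a b
  proof -
    have "a \<noteq> b" using disjoint_family_onD[OF dis that(1-3)] that(4,5) by blast
    with that show ?thesis by (auto simp: adj verts zero_union_mult_distinct[OF dis])
  qed
  have noncentral: "?N k \<noteq> {}" if "\<not> commutative_on (S k) (m k)" for k
    using that by (auto simp: commutative_on_def center_def)
  have le: "graph_dist G x y \<le> 2" if xy: "x \<in> verts G" "y \<in> verts G" for x y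
  proof -
    from xy obtain k l a b where *: "k \<in> I" "l \<in> I" "a \<in> ?N k" "b \<in> ?N l"
      and eq: "x = Some a" "y = Some b" unfolding verts by blast
    have "x \<rightarrow>\<^bsub>G\<^esub> y \<or> (\<exists>w. x \<rightarrow>\<^bsub>G\<^esub> w \<and> w \<rightarrow>\<^bsub>G\<^esub> y)"
    proof (cases "k = l")
      case True
      (* At least one of the two non-commutative summands differs from S k. *)
      from nc obtain h where h: "h \<in> I" "h \<noteq> k" "\<not> commutative_on (S h) (m h)" by metis
      then obtain c where "c \<in> ?N h" using noncentral by blast
      with True * h have "x \<rightarrow>\<^bsub>G\<^esub> Some c" "Some c \<rightarrow>\<^bsub>G\<^esub> y"
        unfolding eq by (blast intro: adj_distinct)+
      then show ?thesis by blast
    next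
      case False
      with * show ?thesis unfolding eq by (blast intro: adj_distinct)
    qed
    with xy show ?thesis by (intro graph_dist_le_two) auto
  qed
  from nc(4) obtain a b where ab: "a \<in> S i" "b \<in> S i" "m i a b \<noteq> m i b a"
    by (auto simp: commutative_on_def)
  have neq: "?f (Some a) (Some b) \<noteq> ?f (Some b) (Some a)"
    using ab by (simp add: zero_union_mult_same[OF dis nc(1)])
  from ab have "a \<in> ?N i" "b \<in> ?N i" unfolding center_def by force+
  with nc(1) have mem: "Some a \<in> verts G" "Some b \<in> verts G" by (auto simp: verts)
  show diam: "graph_diam G = 2"
  proof (rule antisym)
    show "graph_diam G \<le> 2"
      unfolding graph_diam_def by (rule SUP_least) (auto simp: le)
    have "2 \<le> graph_dist G (Some a) (Some b)"
      using neq by (intro graph_dist_ge_two) (auto simp: adj)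
    also have "\<dots> \<le> graph_diam G"
      unfolding graph_diam_def using mem by (intro SUP_upper2[of "(Some a, Some b)"]) auto
    finally show "2 \<le> graph_diam G" .
  qed
  show "connected G"
    using mem diam by (intro connected_if_graph_diam_finite) auto
qed

theorem corollary3p6:
  fixes n :: nat
    and S :: "nat \<Rightarrow> 'a set"
    and m :: "nat \<Rightarrow> 'a \<Rightarrow> 'a \<Rightarrow> 'a"
  assumes semigroups: "\<And>i. i \<in> {1..n} \<Longrightarrow> semigroup_on (S i) (m i)"
    and finite: "\<And>i. i \<in> {1..n} \<Longrightarrow> finite (S i)"
    and disjoint: "disjoint_family_on S {1..n}"
    and NC: "card {i \<in> {1..n}. \<not> commutative_on (S i) (m i)} \<ge> 2"
  defines "G \<equiv> with_proj (commuting_graph (zero_union {1..n} S) (zero_union_mult {1..n} S m))"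
  shows "Digraph_Component.connected G \<and> graph_diam G = 2"
proof -
  from NC obtain T where "T \<subseteq> {i \<in> {1..n}. \<not> commutative_on (S i) (m i)}" "card T = 2"
    by (rule obtain_subset_with_card_n)
  then obtain i j where "i \<in> {1..n}" "j \<in> {1..n}" "i \<noteq> j"
    "\<not> commutative_on (S i) (m i)" "\<not> commutative_on (S j) (m j)"
    by (auto simp: card_2_iff)
  from commuting_graph_zero_union[OF disjoint this] show ?thesis unfolding G_def by blast
qed

end
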